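(* Let $n\ge 1$ and $2\le d\le n+1$. The $H$-parking functions of the complete hypergraph $H=K_{n+1}^d$ coincide with the set of $\vec{u}$-parking functions, where $\vec{u}=(u_1,\ldots,u_n)$ with $$u_k=\binom{n}{d-1}-\binom{n-k}{d-1}\quad\text{for } k=1,2,\dots,n+1-d,$$ $$u_k=\binom{n}{d-1}\quad\text{for } k=n-d+2,\,n-d+3,\dots,n.$$
   Context: The complete hypergraph $K_{n+1}^d$ has $n+1$ vertices and its set $E$ of hyperedges consists of all $d$-element subsets of the vertex set. One vertex is fixed as the sink, and the nonsink vertices are identified with $[n]=\{1,\dots,n\}$. For a hypergraph $H$ with hyperedge set $E$, sink $q$ and nonsink vertices $[n]$, a nonempty set of vertices $T$ and $v\in T$, set $\deg_T(v)=|\{e\in E: v\in e \text{ and } e\not\subseteq T\}|$. An $H$-parking function is a vector $\vec{c}\in\mathbb{Z}_{\ge 0}^n$ such that for every nonempty $T\subseteq[n]$ there is $i\in T$ with $c_i<\deg_T(i)$. Given a nondecreasing vector $\vec{u}=(u_1,\dots,u_n)$ of nonnegative integers, a vector $\vec{c}\in\mathbb{Z}_{\ge 0}^n$ is a $\vec{u}$-parking function if its nondecreasing rearrangement $c(1)\le c(2)\le\cdots\le c(n)$ satisfies $0\le c(i)<u_i$ for all $i$. *)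

theory Defs
  imports Main "HOL-Library.FuncSet"
begin

text \<open>A finite hypergraph is a pair of its vertex set and its set of hyperedges.\<close>

type_synonym 'a hypergraph = "'a set \<times> 'a set set"

definition complete_hypergraph :: "'a set \<Rightarrow> nat \<Rightarrow> 'a hypergraph" where
  "complete_hypergraph V d = (V, {e. e \<subseteq> V \<and> card e = d})"

definition hyperdeg :: "'a hypergraph \<Rightarrow> 'a set \<Rightarrow> 'a \<Rightarrow> nat" where
  "hyperdeg H T v = card {e \<in> snd H. v \<in> e \<and> \<not> e \<subseteq> T}"

text \<open>
  Vectors of nonnegative integers indexed by a set \<open>I\<close> are the elements of
  \<open>I \<rightarrow>\<^sub>E UNIV\<close>: natural-valued functions that are fixed to \<open>undefined\<close> off \<open>I\<close>, so that
  equality of functions is equality of vectors.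
\<close>

definition H_parking_functions :: "'a hypergraph \<Rightarrow> 'a \<Rightarrow> ('a \<Rightarrow> nat) set" where
  "H_parking_functions H q =
     {c \<in> (fst H - {q}) \<rightarrow>\<^sub>E UNIV.
        \<forall>T. T \<noteq> {} \<and> T \<subseteq> fst H - {q} \<longrightarrow> (\<exists>i\<in>T. c i < hyperdeg H T i)}"

text \<open>
  The notion is only meant for nondecreasing \<open>u\<close>, which is therefore part of the condition.
  List positions start at 0, so \<open>sort (map c [1..<Suc n]) ! (k - 1)\<close> is the \<open>k\<close>-th entry
  \<open>c(k)\<close> of the nondecreasing rearrangement of \<open>(c 1, \<dots>, c n)\<close>.
\<close>

definition u_parking_functions :: "nat \<Rightarrow> (nat \<Rightarrow> nat) \<Rightarrow> (nat \<Rightarrow> nat) set" where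
  "u_parking_functions n u =
     {c \<in> {1..n} \<rightarrow>\<^sub>E UNIV.
        mono_on {1..n} u \<and> (\<forall>k\<in>{1..n}. sort (map c [1..<Suc n]) ! (k - 1) < u k)}"

end

theory Submission
  imports Defs
begin

text \<open>
  In a complete hypergraph the outgoing degree of a vertex \<open>v \<in> T\<close> sees \<open>T\<close> only through its
  size: of the \<open>n choose (d - 1)\<close> hyperedges through \<open>v\<close>, exactly
  \<open>(card T - 1) choose (d - 1)\<close> stay inside \<open>T\<close>
  (\<open>hyperdeg_complete_hypergraph\<close>). The parking condition therefore asks, for each size
  \<open>t\<close>, that no \<open>t\<close> vertices all carry values at or above the threshold
  \<open>(n choose (d - 1)) - ((t - 1) choose (d - 1))\<close>; in other words, that fewer than \<open>t\<close>
  vertices do so.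

  With \<open>t = n + 1 - k\<close> the threshold is \<open>u k\<close>, since \<open>t - 1 = n - k\<close>, and the condition
  becomes that at least \<open>k\<close> entries of \<open>c\<close> are below \<open>u k\<close>
  (\<open>thresholds_by_size_iff_counts\<close>). That is precisely what it means for the \<open>k\<close>-th smallest
  entry to be below \<open>u k\<close> (\<open>sort_nth_less_iff\<close>). The two cases in the description of \<open>u\<close> are
  one formula, because \<open>(n - k) choose (d - 1)\<close> vanishes once \<open>n - k < d - 1\<close>; it also shows
  that \<open>u\<close> is nondecreasing.
\<close>

text \<open>Removing \<open>v\<close> matches these sets with the \<open>k\<close>-element subsets of \<open>A - {v}\<close>.\<close>

lemma card_subsets_containing:
  assumes "finite A" and "v \<in> A"
  shows "card {e. e \<subseteq> A \<and> card e = Suc k \<and> v \<in> e} = (card A - 1) choose k"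
proof -
  have "bij_betw (insert v) {s. s \<subseteq> A - {v} \<and> card s = k}
          {e. e \<subseteq> A \<and> card e = Suc k \<and> v \<in> e}"
  proof (rule bij_betw_byWitness[where f' = "\<lambda>e. e - {v}"])
    show "insert v ` {s. s \<subseteq> A - {v} \<and> card s = k} \<subseteq> {e. e \<subseteq> A \<and> card e = Suc k \<and> v \<in> e}"
    proof
      fix e assume "e \<in> insert v ` {s. s \<subseteq> A - {v} \<and> card s = k}"
      then obtain s where s: "e = insert v s" "s \<subseteq> A - {v}" "card s = k" by blast
      then have "finite s" "v \<notin> s" using assms(1) by (auto intro: finite_subset)
      then show "e \<in> {e. e \<subseteq> A \<and> card e = Suc k \<and> v \<in> e}" using s assms(2) by auto
    qed
  qed auto
  then have "card {e. e \<subseteq> A \<and> card e = Suc k \<and> v \<in> e} = card {s. s \<subseteq> A - {v} \<and> card s = k}"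
    by (simp add: bij_betw_same_card)
  also have "\<dots> = card (A - {v}) choose k"
    by (rule n_subsets) (simp add: assms(1))
  finally show ?thesis using assms by simp
qed

lemma hyperdeg_complete_hypergraph:
  assumes "finite V" and "T \<subseteq> V" and "v \<in> T" and "d \<ge> 1"
  shows "hyperdeg (complete_hypergraph V d) T v
       = ((card V - 1) choose (d - 1)) - ((card T - 1) choose (d - 1))"
proof -
  let ?through = "\<lambda>A. {e. e \<subseteq> A \<and> card e = Suc (d - 1) \<and> v \<in> e}"
  have finT: "finite T" using assms(1,2) by (rule finite_subset[rotated])
  have "{e \<in> snd (complete_hypergraph V d). v \<in> e \<and> \<not> e \<subseteq> T} = ?through V - ?through T"
    using assms(4) by (auto simp: complete_hypergraph_def)
  moreover have "card (?through V - ?through T) = card (?through V) - card (?through T)"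
    using assms(2) finT by (intro card_Diff_subset) (auto intro: finite_subset)
  moreover have "card (?through V) = (card V - 1) choose (d - 1)"
    using assms(1-3) by (intro card_subsets_containing) auto
  moreover have "card (?through T) = (card T - 1) choose (d - 1)"
    using finT assms(3) by (rule card_subsets_containing)
  ultimately show ?thesis
    unfolding hyperdeg_def by (simp only:)
qed

text \<open>
  The elements violating \<open>P\<close> contain an \<open>m\<close>-element set exactly when there are at least \<open>m\<close> of
  them.
\<close>

lemma all_subsets_of_card_meet_iff:
  assumes "finite I"
  shows "(\<forall>T. T \<subseteq> I \<and> card T = m \<longrightarrow> (\<exists>i\<in>T. P i)) \<longleftrightarrow> card {i \<in> I. \<not> P i} < m"
proof
  assume meet: "\<forall>T. T \<subseteq> I \<and> card T = m \<longrightarrow> (\<exists>i\<in>T. P i)"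
  show "card {i \<in> I. \<not> P i} < m"
  proof (rule ccontr)
    assume "\<not> card {i \<in> I. \<not> P i} < m"
    then obtain T where "T \<subseteq> {i \<in> I. \<not> P i}" "card T = m"
      by (meson not_less obtain_subset_with_card_n)
    then show False using meet by blast
  qed
next
  assume few: "card {i \<in> I. \<not> P i} < m"
  show "\<forall>T. T \<subseteq> I \<and> card T = m \<longrightarrow> (\<exists>i\<in>T. P i)"
  proof (intro allI impI, rule ccontr)
    fix T assume T: "T \<subseteq> I \<and> card T = m" and "\<not> (\<exists>i\<in>T. P i)"
    then have "T \<subseteq> {i \<in> I. \<not> P i}" by blast
    then have "card T \<le> card {i \<in> I. \<not> P i}" using assms by (intro card_mono) auto
    then show False using few T by simp
  qed
qed

text \<open>
  A condition on all nonempty subsets whose threshold depends on the size alone is a family of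
  counting conditions, one per size. Complementary counting turns ``fewer than \<open>n + 1 - k\<close>
  entries are large'' into ``at least \<open>k\<close> entries are small''.
\<close>

lemma thresholds_by_size_iff_counts:
  fixes c :: "'a \<Rightarrow> 'b::linorder"
  assumes "finite I"
  shows "(\<forall>T. T \<noteq> {} \<and> T \<subseteq> I \<longrightarrow> (\<exists>i\<in>T. c i < w (card T)))
     \<longleftrightarrow> (\<forall>k\<in>{1..card I}. k \<le> card {i \<in> I. c i < w (card I + 1 - k)})"
proof -
  let ?n = "card I"
  have "(\<forall>T. T \<noteq> {} \<and> T \<subseteq> I \<longrightarrow> (\<exists>i\<in>T. c i < w (card T)))
     \<longleftrightarrow> (\<forall>t\<in>{1..?n}. \<forall>T. T \<subseteq> I \<and> card T = t \<longrightarrow> (\<exists>i\<in>T. c i < w t))" (is "?A \<longleftrightarrow> ?B")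
  proof
    assume A: ?A
    show ?B
    proof (intro ballI allI impI)
      fix t T assume t: "t \<in> {1..?n}" and T: "T \<subseteq> I \<and> card T = t"
      then have "T \<noteq> {}" by auto
      then show "\<exists>i\<in>T. c i < w t" using A T by blast
    qed
  next
    assume B: ?B
    show ?A
    proof (intro allI impI)
      fix T assume T: "T \<noteq> {} \<and> T \<subseteq> I"
      then have "finite T" using assms finite_subset by blast
      then have "card T \<in> {1..?n}"
        using T assms by (auto simp: Suc_le_eq card_gt_0_iff intro: card_mono)
      then show "\<exists>i\<in>T. c i < w (card T)" using B T by blast
    qed
  qed
  also have "\<dots> \<longleftrightarrow> (\<forall>t\<in>{1..?n}. card {i \<in> I. \<not> c i < w t} < t)"
    by (simp only: all_subsets_of_card_meet_iff[OF assms])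
  also have "\<dots> \<longleftrightarrow> (\<forall>k\<in>{1..?n}. card {i \<in> I. \<not> c i < w (?n + 1 - k)} < ?n + 1 - k)"
  proof -
    have "(\<lambda>k. ?n + 1 - k) ` {1..?n} = {1..?n}"
    proof -
      have "t \<in> (\<lambda>k. ?n + 1 - k) ` {1..?n}" if "t \<in> {1..?n}" for t
        using that by (intro image_eqI[of _ _ "?n + 1 - t"]) auto
      then show ?thesis by auto
    qed
    then have "(\<forall>t\<in>{1..?n}. card {i \<in> I. \<not> c i < w t} < t)
      \<longleftrightarrow> (\<forall>t\<in>(\<lambda>k. ?n + 1 - k) ` {1..?n}. card {i \<in> I. \<not> c i < w t} < t)" by simp
    then show ?thesis by (simp only: ball_simps(9))
  qed
  also have "\<dots> \<longleftrightarrow> (\<forall>k\<in>{1..?n}. k \<le> card {i \<in> I. c i < w (?n + 1 - k)})"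
  proof (rule ball_cong[OF refl])
    fix k assume k: "k \<in> {1..?n}"
    let ?w = "w (?n + 1 - k)"
    have "card {i \<in> I. c i < ?w} + card {i \<in> I. \<not> c i < ?w} = ?n"
      using assms by (subst card_Un_disjoint[symmetric]) (auto intro: arg_cong[where f = card])
    then show "card {i \<in> I. \<not> c i < ?w} < ?n + 1 - k \<longleftrightarrow> k \<le> card {i \<in> I. c i < ?w}"
      using k by auto
  qed
  finally show ?thesis .
qed

text \<open>In a sorted list the entries below \<open>m\<close> form an initial segment.\<close>

lemma sorted_nth_less_iff:
  assumes "sorted xs" and "j < length xs"
  shows "xs ! j < m \<longleftrightarrow> j < length (filter (\<lambda>x. x < m) xs)"
  using assms
proof (induction xs arbitrary: j)
  case Nil
  then show ?case by simp
next
  case (Cons x xs)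
  show ?case
  proof (cases "x < m")
    case True
    then show ?thesis using Cons by (cases j) auto
  next
    case False
    \<comment> \<open>The head is already too large, so nothing passes the filter and no entry is below \<open>m\<close>.\<close>
    then have "\<forall>y\<in>set (x # xs). \<not> y < m" using Cons.prems(1) by auto
    moreover have "(x # xs) ! j \<in> set (x # xs)" using Cons.prems(2) by (rule nth_mem)
    ultimately show ?thesis by (metis filter_False length_0_conv not_less_zero)
  qed
qed

lemma sort_nth_less_iff:
  assumes "j < length xs"
  shows "sort xs ! j < m \<longleftrightarrow> j < length (filter (\<lambda>x. x < m) xs)"
  using sorted_nth_less_iff[of "sort xs" j m] assms by (simp add: filter_sort)

theorem theorem3p12:
  fixes n d q :: nat and u :: "nat \<Rightarrow> nat"
  assumes "n \<ge> 1" and "2 \<le> d" and "d \<le> n + 1"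
    and "q \<notin> {1..n}"
    and "\<And>k. k \<in> {1..n + 1 - d} \<Longrightarrow> u k = (n choose (d - 1)) - ((n - k) choose (d - 1))"
    and "\<And>k. k \<in> {n + 2 - d..n} \<Longrightarrow> u k = (n choose (d - 1))"
  shows "H_parking_functions (complete_hypergraph (insert q {1..n}) d) q = u_parking_functions n u"
proof -
  let ?H = "complete_hypergraph (insert q {1..n}) d"
  define w where "w t = (n choose (d - 1)) - ((t - 1) choose (d - 1))" for t
  have u: "u k = (n choose (d - 1)) - ((n - k) choose (d - 1))" if "k \<in> {1..n}" for k
  proof (cases "k \<le> n + 1 - d")
    case True
    then show ?thesis using assms(5) that by simp
  next
    case False
    then have "(n - k) choose (d - 1) = 0" using assms(3) that by (intro binomial_eq_0) auto
    moreover have "u k = n choose (d - 1)" using False that by (intro assms(6)) auto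
    ultimately show ?thesis by (simp only: diff_zero)
  qed
  have u_w: "w (n + 1 - k) = u k" if "k \<in> {1..n}" for k
    using u[OF that] by (simp add: w_def)
  have "mono_on {1..n} u"
    by (intro mono_onI) (simp add: u diff_le_mono2 binomial_right_mono)
  moreover have "fst ?H - {q} = {1..n}"
    using assms(4) by (auto simp: complete_hypergraph_def)
  moreover have "(\<forall>T. T \<noteq> {} \<and> T \<subseteq> {1..n} \<longrightarrow> (\<exists>i\<in>T. c i < hyperdeg ?H T i))
      \<longleftrightarrow> (\<forall>k\<in>{1..n}. sort (map c [1..<Suc n]) ! (k - 1) < u k)" for c :: "nat \<Rightarrow> nat"
  proof -
    have deg: "hyperdeg ?H T i = w (card T)" if "T \<subseteq> {1..n}" "i \<in> T" for T i
      using that assms(2,4) hyperdeg_complete_hypergraph[of "insert q {1..n}" T i d]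
      by (auto simp: w_def)
    have "(\<forall>T. T \<noteq> {} \<and> T \<subseteq> {1..n} \<longrightarrow> (\<exists>i\<in>T. c i < hyperdeg ?H T i))
        \<longleftrightarrow> (\<forall>T. T \<noteq> {} \<and> T \<subseteq> {1..n} \<longrightarrow> (\<exists>i\<in>T. c i < w (card T)))"
      by (intro all_cong bex_cong refl) (simp only: deg)
    also have "\<dots> \<longleftrightarrow> (\<forall>k\<in>{1..n}. k \<le> card {i \<in> {1..n}. c i < u k})"
      using thresholds_by_size_iff_counts[of "{1..n}" c w] u_w by simp
    also have "\<dots> \<longleftrightarrow> (\<forall>k\<in>{1..n}. sort (map c [1..<Suc n]) ! (k - 1) < u k)"
    proof (rule ball_cong[OF refl])
      fix k assume k: "k \<in> {1..n}"
      have "length (filter (\<lambda>x. x < u k) (map c [1..<Suc n]))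
          = card (set (filter (\<lambda>i. c i < u k) [1..<Suc n]))"
        by (subst distinct_card) (simp_all del: upt_Suc add: filter_map o_def)
      also have "set (filter (\<lambda>i. c i < u k) [1..<Suc n]) = {i \<in> {1..n}. c i < u k}"
        by (auto simp del: upt_Suc)
      finally have "length (filter (\<lambda>x. x < u k) (map c [1..<Suc n]))
          = card {i \<in> {1..n}. c i < u k}" .
      then have "sort (map c [1..<Suc n]) ! (k - 1) < u k
          \<longleftrightarrow> k - 1 < card {i \<in> {1..n}. c i < u k}"
        using k by (subst sort_nth_less_iff) auto
      then show "k \<le> card {i \<in> {1..n}. c i < u k}
          \<longleftrightarrow> sort (map c [1..<Suc n]) ! (k - 1) < u k"
        using k by (simp only: atLeastAtMost_iff) linarith
    qed
    finally show ?thesis .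
  qed
  ultimately show ?thesis
    by (simp add: H_parking_functions_def u_parking_functions_def del: upt_Suc)
qed

end
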